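(* Let $\Gamma$ be a countable group, let $(X,\mu)$ be a standard probability space with a probability measure preserving $\Gamma$-action, and let $A,B\in\mathrm{MALG}(X,\mu)$. Then $\nu(A)=\nu(B)$ for every $\Gamma$-invariant measure $\nu\ll\mu$ on $X$ if and only if $A$ and $B$ are equidecomposable, i.e. there are $(A_\gamma)_{\gamma\in\Gamma}$ in $\mathrm{MALG}(X,\mu)$ such that the $A_\gamma$ are mutually disjoint with union $A$, and the $\gamma A_\gamma$ are mutually disjoint with union $B$ (all in $\mathrm{MALG}(X,\mu)$, i.e. modulo $\mu$-null sets).
   Context: A probability measure preserving $\Gamma$-action on a standard probability space $(X,\mu)$ is an action of $\Gamma$ on $X$ by $\mu$-preserving Borel automorphisms. $\mathrm{MALG}(X,\mu)$ denotes the measure algebra: the Boolean algebra of measurable subsets of $X$ modulo $\mu$-null sets, with the induced action of $\Gamma$. For $\nu\ll\mu$ (absolutely continuous), $\nu(A)$ is well defined for $A\in\mathrm{MALG}(X,\mu)$. *)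

theory Defs
  imports "HOL-Probability.Probability" "HOL-Algebra.Group_Action"
begin

definition standard_borel :: "'a measure \<Rightarrow> bool" where
  "standard_borel M \<longleftrightarrow>
     (\<exists>T. topspace T = space M \<and> completely_metrizable_space T \<and> separable_space T \<and>
          sets M = sigma_sets (space M) {U. openin T U})"

definition standard_prob_space :: "'a measure \<Rightarrow> bool" where
  "standard_prob_space M \<longleftrightarrow> prob_space M \<and> standard_borel M"

text \<open>
  Applied to an action by bijections of the space, measurability of all \<open>\<phi> g\<close> makes each
  of them an automorphism of the measurable space, because the inverse of \<open>\<phi> g\<close> is the action
  of the inverse of \<open>g\<close>. No finiteness of \<open>N\<close> is required.
\<close>

definition invariant_measure ::
    "('g, 'm) monoid_scheme \<Rightarrow> ('g \<Rightarrow> 'a \<Rightarrow> 'a) \<Rightarrow> 'a measure \<Rightarrow> bool" where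
  "invariant_measure G \<phi> N \<longleftrightarrow> (\<forall>g\<in>carrier G. \<phi> g \<in> measurable N N \<and> distr N N (\<phi> g) = N)"

definition pmp_action ::
    "('g, 'm) monoid_scheme \<Rightarrow> 'a measure \<Rightarrow> ('g \<Rightarrow> 'a \<Rightarrow> 'a) \<Rightarrow> bool" where
  "pmp_action G M \<phi> \<longleftrightarrow> group_action G (space M) \<phi> \<and> invariant_measure G \<phi> M"


section \<open>The measure algebra\<close>

definition malg_rel :: "'a measure \<Rightarrow> 'a set rel" where
  "malg_rel M = {(S, T). S \<in> sets M \<and> T \<in> sets M \<and> (S - T) \<union> (T - S) \<in> null_sets M}"

definition MALG :: "'a measure \<Rightarrow> 'a set set set" where
  "MALG M = sets M // malg_rel M"

abbreviation malg_class :: "'a measure \<Rightarrow> 'a set \<Rightarrow> 'a set set" where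
  "malg_class M S \<equiv> malg_rel M `` {S}"

text \<open>
  The operations are induced from those on sets, in the style of \<^theory>\<open>HOL.Equiv_Relations\<close>:
  each union below ranges over choices of representatives, all of which yield the same class.
  The lemmas at the end of the theory confirm this.
\<close>

definition malg_Int :: "'a measure \<Rightarrow> 'a set set \<Rightarrow> 'a set set \<Rightarrow> 'a set set" where
  "malg_Int M a b = (\<Union>S\<in>a. \<Union>T\<in>b. malg_class M (S \<inter> T))"

definition malg_UN :: "'a measure \<Rightarrow> 'i set \<Rightarrow> ('i \<Rightarrow> 'a set set) \<Rightarrow> 'a set set" where
  "malg_UN M I a = (\<Union>R\<in>Pi I a. malg_class M (\<Union>i\<in>I. R i))"

definition malg_act ::
    "'a measure \<Rightarrow> ('g \<Rightarrow> 'a \<Rightarrow> 'a) \<Rightarrow> 'g \<Rightarrow> 'a set set \<Rightarrow> 'a set set" where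
  "malg_act M \<phi> g a = (\<Union>S\<in>a. malg_class M (\<phi> g ` S))"

definition malg_disjoint_family ::
    "'a measure \<Rightarrow> 'i set \<Rightarrow> ('i \<Rightarrow> 'a set set) \<Rightarrow> bool" where
  "malg_disjoint_family M I a \<longleftrightarrow>
     (\<forall>i\<in>I. \<forall>j\<in>I. i \<noteq> j \<longrightarrow> malg_Int M (a i) (a j) = malg_class M {})"

text \<open>
  The common value of a measure on the representatives of a class; meaningful for measures
  absolutely continuous with respect to the one defining the measure algebra.
\<close>

definition malg_emeasure :: "'a measure \<Rightarrow> 'a set set \<Rightarrow> ennreal" where
  "malg_emeasure N a = the_elem (emeasure N ` a)"

definition equidecomposable ::
    "('g, 'm) monoid_scheme \<Rightarrow> 'a measure \<Rightarrow> ('g \<Rightarrow> 'a \<Rightarrow> 'a) \<Rightarrow> 'a set set \<Rightarrow> 'a set set \<Rightarrow> bool"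
  where
  "equidecomposable G M \<phi> A B \<longleftrightarrow>
     (\<exists>P. (\<forall>g\<in>carrier G. P g \<in> MALG M) \<and>
          malg_disjoint_family M (carrier G) P \<and>
          malg_UN M (carrier G) P = A \<and>
          malg_disjoint_family M (carrier G) (\<lambda>g. malg_act M \<phi> g (P g)) \<and>
          malg_UN M (carrier G) (\<lambda>g. malg_act M \<phi> g (P g)) = B)"


section \<open>Independence of representatives\<close>

lemma malg_rel_iff_AE:
  "(S, T) \<in> malg_rel M \<longleftrightarrow> S \<in> sets M \<and> T \<in> sets M \<and> (AE x in M. x \<in> S \<longleftrightarrow> x \<in> T)"
proof -
  have "(S - T) \<union> (T - S) \<in> null_sets M \<longleftrightarrow> (AE x in M. x \<in> S \<longleftrightarrow> x \<in> T)"
    if "S \<in> sets M" "T \<in> sets M"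
  proof -
    have "(S - T) \<union> (T - S) \<in> null_sets M \<longleftrightarrow> (AE x in M. x \<notin> (S - T) \<union> (T - S))"
      using that by (intro AE_iff_null_sets) auto
    also have "\<dots> \<longleftrightarrow> (AE x in M. x \<in> S \<longleftrightarrow> x \<in> T)"
      by (intro AE_cong) auto
    finally show ?thesis .
  qed
  then show ?thesis by (auto simp: malg_rel_def)
qed

lemma equiv_malg_rel: "equiv (sets M) (malg_rel M)"
proof (rule equivI)
  show "malg_rel M \<subseteq> sets M \<times> sets M" by (auto simp: malg_rel_def)
  show "refl_on (sets M) (malg_rel M)" by (auto simp: refl_on_def malg_rel_def)
  show "sym (malg_rel M)" by (auto simp: sym_def malg_rel_def Un_commute)
  show "trans (malg_rel M)"
  proof (rule transI)
    fix S T U assume *: "(S, T) \<in> malg_rel M" "(T, U) \<in> malg_rel M"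
    then have "AE x in M. x \<in> S \<longleftrightarrow> x \<in> T" "AE x in M. x \<in> T \<longleftrightarrow> x \<in> U"
      by (simp_all add: malg_rel_iff_AE)
    then have "AE x in M. x \<in> S \<longleftrightarrow> x \<in> U"
      by eventually_elim blast
    then show "(S, U) \<in> malg_rel M"
      using * by (simp add: malg_rel_iff_AE)
  qed
qed

lemma malg_class_self: "S \<in> sets M \<Longrightarrow> S \<in> malg_class M S"
  using equiv_class_self[OF equiv_malg_rel] .

lemma malg_class_eq: "(S, T) \<in> malg_rel M \<Longrightarrow> malg_class M S = malg_class M T"
  using equiv_class_eq[OF equiv_malg_rel] .

lemma malg_Int_class:
  assumes "S \<in> sets M" "T \<in> sets M"
  shows "malg_Int M (malg_class M S) (malg_class M T) = malg_class M (S \<inter> T)"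
proof -
  have "malg_class M (S' \<inter> T') = malg_class M (S \<inter> T)"
    if "(S, S') \<in> malg_rel M" "(T, T') \<in> malg_rel M" for S' T'
  proof (rule malg_class_eq)
    have "AE x in M. x \<in> S \<longleftrightarrow> x \<in> S'" "AE x in M. x \<in> T \<longleftrightarrow> x \<in> T'"
      using that by (simp_all add: malg_rel_iff_AE)
    then have "AE x in M. x \<in> S' \<inter> T' \<longleftrightarrow> x \<in> S \<inter> T"
      by eventually_elim blast
    then show "(S' \<inter> T', S \<inter> T) \<in> malg_rel M"
      using that by (auto simp: malg_rel_iff_AE)
  qed
  then show ?thesis
    using malg_class_self[OF assms(1)] malg_class_self[OF assms(2)]
    unfolding malg_Int_def by blast
qed

lemma malg_UN_class:
  assumes "countable I" "\<And>i. i \<in> I \<Longrightarrow> S i \<in> sets M"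
  shows "malg_UN M I (\<lambda>i. malg_class M (S i)) = malg_class M (\<Union>i\<in>I. S i)"
proof -
  have "malg_class M (\<Union>i\<in>I. R i) = malg_class M (\<Union>i\<in>I. S i)"
    if "\<forall>i\<in>I. (S i, R i) \<in> malg_rel M" for R
  proof (intro malg_class_eq, unfold malg_rel_iff_AE, intro conjI)
    show "(\<Union>i\<in>I. R i) \<in> sets M" "(\<Union>i\<in>I. S i) \<in> sets M"
      using that assms by (auto simp: malg_rel_def intro!: sets.countable_UN')
    have "AE x in M. \<forall>i\<in>I. x \<in> S i \<longleftrightarrow> x \<in> R i"
      using that assms(1) by (auto simp: malg_rel_iff_AE AE_ball_countable)
    then show "AE x in M. x \<in> (\<Union>i\<in>I. R i) \<longleftrightarrow> x \<in> (\<Union>i\<in>I. S i)"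
      by eventually_elim auto
  qed
  then have *: "malg_class M (\<Union>i\<in>I. R i) = malg_class M (\<Union>i\<in>I. S i)"
    if "R \<in> Pi I (\<lambda>i. malg_class M (S i))" for R
    using that by (simp add: Pi_iff)
  have S: "S \<in> Pi I (\<lambda>i. malg_class M (S i))"
    using assms(2) malg_class_self by blast
  show ?thesis
    unfolding malg_UN_def
  proof (intro equalityI UN_least)
    show "malg_class M (\<Union>i\<in>I. R i) \<subseteq> malg_class M (\<Union>i\<in>I. S i)"
      if "R \<in> Pi I (\<lambda>i. malg_class M (S i))" for R
      by (rule equalityD1[OF *[OF that]])
    show "malg_class M (\<Union>i\<in>I. S i)
        \<subseteq> (\<Union>R\<in>Pi I (\<lambda>i. malg_class M (S i)). malg_class M (\<Union>i\<in>I. R i))"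
      by (rule UN_upper[OF S])
  qed
qed

lemma pmp_action_image:
  assumes "pmp_action G M \<phi>" "g \<in> carrier G" "S \<in> sets M"
  shows "\<phi> g ` S = \<phi> (inv\<^bsub>G\<^esub> g) -` S \<inter> space M"
proof -
  interpret group_action G "space M" \<phi>
    using assms(1) by (simp add: pmp_action_def)
  interpret group G
    using group_hom by (simp add: group_hom_def)
  have sub: "S \<subseteq> space M" using sets.sets_into_space[OF assms(3)] .
  have img: "\<phi> h x \<in> space M" if "h \<in> carrier G" "x \<in> space M" for h x
    using element_image[OF that] by simp
  have 1: "\<phi> (inv\<^bsub>G\<^esub> g) (\<phi> g x) = x" if "x \<in> space M" for x
    using orbit_sym_aux[OF assms(2) that] by simp
  have 2: "\<phi> g (\<phi> (inv\<^bsub>G\<^esub> g) x) = x" if "x \<in> space M" for x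
    using orbit_sym_aux[OF inv_closed[OF assms(2)] that] assms(2) by simp
  show ?thesis
  proof (intro equalityI subsetI)
    fix y assume "y \<in> \<phi> g ` S"
    then show "y \<in> \<phi> (inv\<^bsub>G\<^esub> g) -` S \<inter> space M"
      using sub 1 img assms(2) by auto
  next
    fix y assume "y \<in> \<phi> (inv\<^bsub>G\<^esub> g) -` S \<inter> space M"
    then show "y \<in> \<phi> g ` S"
      using 2[of y] by (intro image_eqI[of _ _ "\<phi> (inv\<^bsub>G\<^esub> g) y"]) auto
  qed
qed

lemma malg_act_class:
  assumes "pmp_action G M \<phi>" "g \<in> carrier G" "S \<in> sets M"
  shows "malg_act M \<phi> g (malg_class M S) = malg_class M (\<phi> g ` S)"
proof -
  let ?h = "\<phi> (inv\<^bsub>G\<^esub> g)"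
  interpret group_action G "space M" \<phi>
    using assms(1) by (simp add: pmp_action_def)
  interpret group G
    using group_hom by (simp add: group_hom_def)
  have h: "?h \<in> measurable M M" "distr M M ?h = M"
    using assms(1) inv_closed[OF assms(2)] by (auto simp: pmp_action_def invariant_measure_def)
  have "malg_class M (\<phi> g ` S') = malg_class M (\<phi> g ` S)" if "(S, S') \<in> malg_rel M" for S'
  proof (rule malg_class_eq)
    have S': "S' \<in> sets M" and "AE x in M. x \<in> S \<longleftrightarrow> x \<in> S'"
      using that by (auto simp: malg_rel_iff_AE)
    then have "AE x in distr M M ?h. x \<in> S \<longleftrightarrow> x \<in> S'"
      by (simp only: h(2))
    then have "AE x in M. ?h x \<in> S \<longleftrightarrow> ?h x \<in> S'"
      using AE_distrD[OF h(1)] by blast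
    then show "(\<phi> g ` S', \<phi> g ` S) \<in> malg_rel M"
      using h(1) S' assms by (auto simp: malg_rel_iff_AE pmp_action_image[OF assms(1,2)])
  qed
  then show ?thesis
    using malg_class_self[OF assms(3)] unfolding malg_act_def by blast
qed

lemma malg_emeasure_class:
  assumes "sets N = sets M" "absolutely_continuous M N" "S \<in> sets M"
  shows "malg_emeasure N (malg_class M S) = emeasure N S"
proof -
  have "emeasure N T = emeasure N S" if "(S, T) \<in> malg_rel M" for T
  proof (rule emeasure_eq_AE)
    have "(S - T) \<union> (T - S) \<in> null_sets N"
      using that assms(2) by (auto simp: malg_rel_def absolutely_continuous_def)
    then show "AE x in N. x \<in> T \<longleftrightarrow> x \<in> S"
      by (rule AE_I') auto
  qed (use that assms in \<open>auto simp: malg_rel_def\<close>)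
  then have "emeasure N ` malg_class M S = {emeasure N S}"
    using malg_class_self[OF assms(3)] by blast
  then show ?thesis
    by (simp add: malg_emeasure_def)
qed

end

(* To build a decomposition, enumerate the group and greedily let each element g_n in turn move as
   much as possible of what is left of A into what is left of B. Afterwards no translate of the
   remainder A' of A meets the remainder B' of B, so the saturation C of A' is an invariant set
   disjoint from B'. The restriction of the measure to C is invariant and finite, gives A and B
   equal mass by hypothesis, and gives equal mass to the parts already matched; as it does not
   charge B', it does not charge A' either, so A' is null. By symmetry B' is null. The converse
   is countable additivity. *)
theory Submission
  imports Defs
begin

section \<open>Classes of sets in the measure algebra\<close>

text \<open>As \<open>I\<close> is countable, the pairwise intersections together form a null set
  \<open>Z\<close>. Removing \<open>Z\<close> from every member makes the family disjoint in the
  strict sense and changes no measure, so ordinary countable additivity applies.\<close>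

lemma emeasure_UN_countable_AE_disjoint:
  assumes "countable I" and F: "\<And>i. i \<in> I \<Longrightarrow> F i \<in> sets M"
    and null: "\<And>i j. i \<in> I \<Longrightarrow> j \<in> I \<Longrightarrow> i \<noteq> j \<Longrightarrow> F i \<inter> F j \<in> null_sets M"
  shows "emeasure M (\<Union>i\<in>I. F i) = (\<integral>\<^sup>+i. emeasure M (F i) \<partial>count_space I)"
proof -
  define Z where "Z = (\<Union>i\<in>I. \<Union>j\<in>I - {i}. F i \<inter> F j)"
  have Z: "Z \<in> null_sets M"
    unfolding Z_def using assms by (intro null_sets_UN') auto
  have U: "(\<Union>i\<in>I. F i) \<in> sets M"
    using assms by (intro sets.countable_UN') auto
  have "emeasure M (\<Union>i\<in>I. F i) = emeasure M ((\<Union>i\<in>I. F i) - Z)"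
    using emeasure_Diff_null_set[OF Z U] by simp
  also have "\<dots> = emeasure M (\<Union>i\<in>I. F i - Z)"
    by (rule arg_cong[of _ _ "emeasure M"]) auto
  also have "\<dots> = (\<integral>\<^sup>+i. emeasure M (F i - Z) \<partial>count_space I)"
  proof (rule emeasure_UN_countable)
    show "disjoint_family_on (\<lambda>i. F i - Z) I"
      unfolding disjoint_family_on_def Z_def by blast
  qed (use assms Z in auto)
  also have "\<dots> = (\<integral>\<^sup>+i. emeasure M (F i) \<partial>count_space I)"
    using emeasure_Diff_null_set[OF Z F] by (intro nn_integral_cong) simp
  finally show ?thesis .
qed

lemma malg_class_eq_iff:
  assumes "S \<in> sets M" "T \<in> sets M"
  shows "malg_class M S = malg_class M T \<longleftrightarrow> (S, T) \<in> malg_rel M"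
  using eq_equiv_class_iff[OF equiv_malg_rel assms] .

lemma malg_class_eq_empty_iff:
  assumes "S \<in> sets M"
  shows "malg_class M S = malg_class M {} \<longleftrightarrow> S \<in> null_sets M"
  using assms by (simp add: malg_class_eq_iff) (simp add: malg_rel_def)

lemma malg_disjoint_family_class_iff:
  assumes "\<And>i. i \<in> I \<Longrightarrow> a i = malg_class M (S i)" "\<And>i. i \<in> I \<Longrightarrow> S i \<in> sets M"
  shows "malg_disjoint_family M I a \<longleftrightarrow>
    (\<forall>i\<in>I. \<forall>j\<in>I. i \<noteq> j \<longrightarrow> S i \<inter> S j \<in> null_sets M)"
  using assms
  by (simp add: malg_disjoint_family_def malg_Int_class malg_class_eq_empty_iff sets.Int)

text \<open>\<open>Pi I a\<close> depends only on the values of \<open>a\<close> on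
  \<open>I\<close>, so representatives chosen on \<open>I\<close> alone are enough to evaluate the
  union.\<close>

lemma malg_UN_eq_class:
  assumes "countable I" "\<And>i. i \<in> I \<Longrightarrow> a i = malg_class M (S i)" "\<And>i. i \<in> I \<Longrightarrow> S i \<in> sets M"
  shows "malg_UN M I a = malg_class M (\<Union>i\<in>I. S i)"
proof -
  have "Pi I a = Pi I (\<lambda>i. malg_class M (S i))"
    using assms(2) by (auto simp: Pi_iff)
  then have "malg_UN M I a = malg_UN M I (\<lambda>i. malg_class M (S i))"
    by (simp add: malg_UN_def)
  then show ?thesis
    using malg_UN_class[OF assms(1,3)] by simp
qed

lemma emeasure_eq_malg_rel:
  assumes "sets N = sets M" "absolutely_continuous M N" "(S, T) \<in> malg_rel M"
  shows "emeasure N S = emeasure N T"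
proof -
  have "S \<in> sets M" "T \<in> sets M"
    using assms(3) by (simp_all add: malg_rel_def)
  then show ?thesis
    using malg_emeasure_class[OF assms(1,2)] malg_class_eq[OF assms(3)] by metis
qed

section \<open>Countable groups acting on a measure space\<close>

locale countable_pmp_action = group_action G "space M" \<phi>
  for G :: "('g, 'm) monoid_scheme" (structure) and M :: "'a measure" and \<phi> :: "'g \<Rightarrow> 'a \<Rightarrow> 'a" +
  assumes countable_carrier: "countable (carrier G)"
    and invariant: "invariant_measure G \<phi> M"
begin

sublocale group G
  using group_hom by (simp add: group_hom_def)

lemma pmp: "pmp_action G M \<phi>"
  using group_action_axioms invariant by (simp add: pmp_action_def)

lemma act_inv_act: "g \<in> carrier G \<Longrightarrow> x \<in> space M \<Longrightarrow> \<phi> (inv g) (\<phi> g x) = x"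
  using orbit_sym_aux by blast

lemma measurable_act: "g \<in> carrier G \<Longrightarrow> \<phi> g \<in> measurable M M"
  using invariant by (simp add: invariant_measure_def)

lemma image_act_sets:
  assumes "g \<in> carrier G" "S \<in> sets M"
  shows "\<phi> g ` S \<in> sets M"
  unfolding pmp_action_image[OF pmp assms]
  using assms by (intro measurable_sets[OF measurable_act]) auto

text \<open>The image under \<open>g\<close> is the preimage under \<open>inv g\<close>, to which
  invariance applies. The measure is a general \<open>N\<close> because the matched pieces have to
  be compared under every invariant measure, not only under \<open>M\<close>.\<close>

lemma emeasure_image_act:
  assumes "sets N = sets M" "invariant_measure G \<phi> N" "g \<in> carrier G" "S \<in> sets M"
  shows "emeasure N (\<phi> g ` S) = emeasure N S"
proof -
  have space: "space N = space M"
    using assms(1) by (rule sets_eq_imp_space_eq)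
  have h: "\<phi> (inv g) \<in> measurable N N" "distr N N (\<phi> (inv g)) = N"
    using assms(2,3) by (auto simp: invariant_measure_def)
  have "emeasure N (\<phi> g ` S) = emeasure N (\<phi> (inv g) -` S \<inter> space N)"
    by (simp add: pmp_action_image[OF pmp assms(3,4)] space)
  also have "\<dots> = emeasure (distr N N (\<phi> (inv g))) S"
    using h(1) assms by (simp add: emeasure_distr)
  finally show ?thesis
    by (simp add: h(2))
qed

text \<open>Since \<open>C\<close> is invariant, intersecting a preimage with \<open>C\<close> is
  the same as taking the preimage of an intersection with \<open>C\<close>; invariance of
  \<open>M\<close> then passes to its restriction. These restrictions are the test measures for the
  harder implication.\<close>

lemma invariant_measure_density_indicator:
  assumes C: "C \<in> sets M"
    and inv: "\<And>g x. g \<in> carrier G \<Longrightarrow> x \<in> space M \<Longrightarrow> \<phi> g x \<in> C \<longleftrightarrow> x \<in> C"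
  shows "invariant_measure G \<phi> (density M (indicator C))"
  unfolding invariant_measure_def
proof (intro ballI conjI measure_eqI)
  let ?N = "density M (indicator C)"
  fix g assume g: "g \<in> carrier G"
  have m: "\<phi> g \<in> measurable M M" and d: "distr M M (\<phi> g) = M"
    using g invariant by (auto simp: invariant_measure_def)
  show mN: "\<phi> g \<in> measurable ?N ?N"
    using m by simp
  fix S assume "S \<in> sets (distr ?N ?N (\<phi> g))"
  then have S: "S \<in> sets M"
    by simp
  have "emeasure (distr ?N ?N (\<phi> g)) S = emeasure ?N (\<phi> g -` S \<inter> space M)"
    using mN S by (simp add: emeasure_distr)
  also have "\<dots> = emeasure M (C \<inter> (\<phi> g -` S \<inter> space M))"
    using C measurable_sets[OF m S] by (simp add: emeasure_restricted)
  also have "C \<inter> (\<phi> g -` S \<inter> space M) = \<phi> g -` (C \<inter> S) \<inter> space M"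
    using inv[OF g] by blast
  also have "emeasure M \<dots> = emeasure (distr M M (\<phi> g)) (C \<inter> S)"
    using m C S by (simp add: emeasure_distr)
  also have "\<dots> = emeasure ?N S"
    using C S by (simp add: d emeasure_restricted)
  finally show "emeasure (distr ?N ?N (\<phi> g)) S = emeasure ?N S" .
qed simp

section \<open>Equidecomposable sets\<close>

text \<open>Equidecomposability in terms of representatives. Disjointness and the two unions are
  required only modulo null sets, because that is all that classes determine about their
  representatives.\<close>

definition decomposition :: "'a set \<Rightarrow> 'a set \<Rightarrow> ('g \<Rightarrow> 'a set) \<Rightarrow> bool" where
  "decomposition S T P \<longleftrightarrow>
     (\<forall>g\<in>carrier G. P g \<in> sets M) \<and>
     (\<forall>g\<in>carrier G. \<forall>h\<in>carrier G. g \<noteq> h \<longrightarrow> P g \<inter> P h \<in> null_sets M) \<and>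
     (\<forall>g\<in>carrier G. \<forall>h\<in>carrier G. g \<noteq> h \<longrightarrow> \<phi> g ` P g \<inter> \<phi> h ` P h \<in> null_sets M) \<and>
     (\<Union>g\<in>carrier G. P g, S) \<in> malg_rel M \<and>
     (\<Union>g\<in>carrier G. \<phi> g ` P g, T) \<in> malg_rel M"

lemma equidecomposable_class_iff:
  assumes S: "S \<in> sets M" and T: "T \<in> sets M"
  shows "equidecomposable G M \<phi> (malg_class M S) (malg_class M T) \<longleftrightarrow> (\<exists>P. decomposition S T P)"
proof -
  \<comment> \<open>All clauses of \<open>equidecomposable\<close> except membership in
    \<open>MALG M\<close>. The equivalence \<open>iff\<close> then serves both directions: from
    classes with chosen representatives, and from given sets to their classes.\<close>
  define equidec where "equidec a \<longleftrightarrow>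
      malg_disjoint_family M (carrier G) a \<and>
      malg_UN M (carrier G) a = malg_class M S \<and>
      malg_disjoint_family M (carrier G) (\<lambda>g. malg_act M \<phi> g (a g)) \<and>
      malg_UN M (carrier G) (\<lambda>g. malg_act M \<phi> g (a g)) = malg_class M T" for a
  have iff: "equidec a \<longleftrightarrow> decomposition S T P"
    if a: "\<And>g. g \<in> carrier G \<Longrightarrow> a g = malg_class M (P g)"
      and P: "\<And>g. g \<in> carrier G \<Longrightarrow> P g \<in> sets M" for a P
  proof -
    have b: "malg_act M \<phi> g (a g) = malg_class M (\<phi> g ` P g)" if "g \<in> carrier G" for g
      using malg_act_class[OF pmp that P[OF that]] a[OF that] by simp
    have Q: "\<phi> g ` P g \<in> sets M" if "g \<in> carrier G" for g
      using image_act_sets[OF that P[OF that]] .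
    have U: "(\<Union>g\<in>carrier G. P g) \<in> sets M" "(\<Union>g\<in>carrier G. \<phi> g ` P g) \<in> sets M"
      using countable_carrier P Q by (auto intro!: sets.countable_UN')
    have "malg_UN M (carrier G) a = malg_class M (\<Union>g\<in>carrier G. P g)"
      using countable_carrier a P by (rule malg_UN_eq_class)
    moreover have "malg_UN M (carrier G) (\<lambda>g. malg_act M \<phi> g (a g)) =
        malg_class M (\<Union>g\<in>carrier G. \<phi> g ` P g)"
      using countable_carrier b Q by (rule malg_UN_eq_class)
    moreover have "malg_disjoint_family M (carrier G) a \<longleftrightarrow>
        (\<forall>g\<in>carrier G. \<forall>h\<in>carrier G. g \<noteq> h \<longrightarrow> P g \<inter> P h \<in> null_sets M)"
      using a P by (rule malg_disjoint_family_class_iff)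
    moreover have "malg_disjoint_family M (carrier G) (\<lambda>g. malg_act M \<phi> g (a g)) \<longleftrightarrow>
        (\<forall>g\<in>carrier G. \<forall>h\<in>carrier G. g \<noteq> h \<longrightarrow> \<phi> g ` P g \<inter> \<phi> h ` P h \<in> null_sets M)"
      using b Q by (rule malg_disjoint_family_class_iff)
    ultimately show ?thesis
      using P by (simp add: equidec_def decomposition_def
          malg_class_eq_iff[OF U(1) S] malg_class_eq_iff[OF U(2) T] conj_ac)
  qed
  show ?thesis
  proof
    assume "equidecomposable G M \<phi> (malg_class M S) (malg_class M T)"
    then obtain a where a: "\<forall>g\<in>carrier G. a g \<in> MALG M" and "equidec a"
      unfolding equidecomposable_def equidec_def by blast
    from a have "\<forall>g\<in>carrier G. \<exists>R. R \<in> sets M \<and> a g = malg_class M R"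
      unfolding MALG_def quotient_def by blast
    then obtain P where P: "\<forall>g\<in>carrier G. P g \<in> sets M \<and> a g = malg_class M (P g)"
      unfolding bchoice_iff by blast
    have "equidec a \<longleftrightarrow> decomposition S T P"
      by (rule iff) (use P in auto)
    then show "\<exists>P. decomposition S T P"
      using \<open>equidec a\<close> by blast
  next
    assume "\<exists>P. decomposition S T P"
    then obtain P where P: "decomposition S T P" ..
    have sets: "P g \<in> sets M" if "g \<in> carrier G" for g
      using P that by (simp add: decomposition_def)
    have "equidec (\<lambda>g. malg_class M (P g)) \<longleftrightarrow> decomposition S T P"
      using refl sets by (rule iff)
    moreover have "malg_class M (P g) \<in> MALG M" if "g \<in> carrier G" for g
      using sets[OF that] unfolding MALG_def by (rule quotientI)
    ultimately show "equidecomposable G M \<phi> (malg_class M S) (malg_class M T)"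
      using P unfolding equidecomposable_def equidec_def
      by (intro exI[of _ "\<lambda>g. malg_class M (P g)"]) simp
  qed
qed

text \<open>Absolute continuity turns the \<open>M\<close>-null overlaps into \<open>N\<close>-null
  ones, so both sides are sums over the group, and these agree term by term because each
  \<open>\<phi> g\<close> preserves \<open>N\<close>. The sums live in \<open>ennreal\<close>, so
  infinite \<open>N\<close> is covered.\<close>

lemma decomposition_emeasure_eq:
  assumes "decomposition S T P"
    and N: "sets N = sets M" "invariant_measure G \<phi> N" "absolutely_continuous M N"
  shows "emeasure N S = emeasure N T"
proof -
  let ?Q = "\<lambda>g. \<phi> g ` P g"
  have P: "P g \<in> sets M" "?Q g \<in> sets M" if "g \<in> carrier G" for g
    using assms(1) that image_act_sets by (auto simp: decomposition_def)
  have null: "P g \<inter> P h \<in> null_sets N" "?Q g \<inter> ?Q h \<in> null_sets N"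
    if "g \<in> carrier G" "h \<in> carrier G" "g \<noteq> h" for g h
    using assms(1) N(3) that by (auto simp: decomposition_def absolutely_continuous_def)
  have "emeasure N S = emeasure N (\<Union>g\<in>carrier G. P g)"
    using assms(1) by (intro emeasure_eq_malg_rel[OF N(1,3), symmetric]) (simp add: decomposition_def)
  also have "\<dots> = (\<integral>\<^sup>+g. emeasure N (P g) \<partial>count_space (carrier G))"
    using countable_carrier P null N(1) by (intro emeasure_UN_countable_AE_disjoint) auto
  also have "\<dots> = (\<integral>\<^sup>+g. emeasure N (?Q g) \<partial>count_space (carrier G))"
    using emeasure_image_act[OF N(1,2)] P by (intro nn_integral_cong) simp
  also have "\<dots> = emeasure N (\<Union>g\<in>carrier G. ?Q g)"
    using countable_carrier P null N(1)
    by (intro emeasure_UN_countable_AE_disjoint[symmetric]) auto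
  also have "\<dots> = emeasure N T"
    using assms(1) by (intro emeasure_eq_malg_rel[OF N(1,3)]) (simp add: decomposition_def)
  finally show ?thesis .
qed

section \<open>Greedy exhaustion along an enumeration of the group\<close>

text \<open>
  The two components are what is left of \<open>S\<close> and of \<open>T\<close> after the first \<open>n\<close> steps; at step \<open>n\<close>
  the group element \<open>from_nat_into (carrier G) n\<close> moves as much as it can.
\<close>

primrec greedy :: "'a set \<Rightarrow> 'a set \<Rightarrow> nat \<Rightarrow> 'a set \<times> 'a set" where
  "greedy S T 0 = (S, T)"
| "greedy S T (Suc n) =
    (let g = from_nat_into (carrier G) n; U = fst (greedy S T n); V = snd (greedy S T n);
         R = U \<inter> (\<phi> g -` V \<inter> space M)
     in (U - R, V - \<phi> g ` R))"

text \<open>Every group element has its turn at some step \<open>n\<close>. A point of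
  \<open>S'\<close> that it carried into \<open>T'\<close> would lie in \<open>U n\<close> and be
  carried into \<open>V n\<close>; it would thus belong to \<open>R n\<close> and be missing from
  \<open>U (Suc n)\<close>. One pass through the group therefore suffices, and no piece has to be
  chosen by the size of its measure.\<close>

lemma maximal_partial_decomposition:
  assumes S: "S \<in> sets M" and T: "T \<in> sets M"
  obtains S' T' P where "S' \<in> sets M" "S' \<subseteq> S" "T' \<in> sets M" "T' \<subseteq> T"
    "decomposition (S - S') (T - T') P"
    "\<forall>g\<in>carrier G. \<forall>x\<in>S'. \<phi> g x \<notin> T'"
proof -
  define e where "e = from_nat_into (carrier G)"
  have e: "range e = carrier G" "\<And>n. e n \<in> carrier G"
    using countable_carrier carrier_not_empty
    by (simp_all add: e_def range_from_nat_into from_nat_into)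
  define U where "U n = fst (greedy S T n)" for n
  define V where "V n = snd (greedy S T n)" for n
  define R where "R n = U n \<inter> (\<phi> (e n) -` V n \<inter> space M)" for n
  have U_0: "U 0 = S" and V_0: "V 0 = T"
    by (simp_all add: U_def V_def)
  have U_Suc: "U (Suc n) = U n - R n" and V_Suc: "V (Suc n) = V n - \<phi> (e n) ` R n" for n
    by (simp_all add: U_def V_def R_def e_def Let_def)
  have R_sets: "R n \<in> sets M" if "U n \<in> sets M" "V n \<in> sets M" for n
    using that measurable_sets[OF measurable_act[OF e(2)]] by (auto simp: R_def)
  have UV: "U n \<in> sets M \<and> V n \<in> sets M" for n
  proof (induction n)
    case 0
    then show ?case using S T by (simp add: U_0 V_0)
  next
    case (Suc n)
    then show ?case
      using R_sets image_act_sets[OF e(2)] by (auto simp: U_Suc V_Suc)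
  qed
  have RM: "R n \<in> sets M" "\<phi> (e n) ` R n \<in> sets M" for n
    using UV R_sets image_act_sets[OF e(2)] by auto
  have dec: "decseq U" "decseq V"
    by (auto intro!: decseq_SucI simp: U_Suc V_Suc)
  have R_sub: "R n \<subseteq> U n" "\<phi> (e n) ` R n \<subseteq> V n" for n
    by (auto simp: R_def)
  \<comment> \<open>For \<open>m < n\<close>, the piece \<open>R n\<close> lies in
    \<open>U (Suc m)\<close>, from which \<open>R m\<close> has been removed; its image lies in
    \<open>V (Suc m)\<close>, from which the image of \<open>R m\<close> has been removed.\<close>
  have R_disj: "R m \<inter> R n = {} \<and> \<phi> (e m) ` R m \<inter> \<phi> (e n) ` R n = {}" if "m < n" for m n
  proof -
    have "U n \<subseteq> U (Suc m)" "V n \<subseteq> V (Suc m)"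
      using that dec[THEN decseqD] by auto
    then show ?thesis
      using R_sub[of n] unfolding U_Suc V_Suc by blast
  qed
  have R_disj: "R m \<inter> R n = {} \<and> \<phi> (e m) ` R m \<inter> \<phi> (e n) ` R n = {}" if "m \<noteq> n" for m n
    using R_disj[of m n] R_disj[of n m] that by (cases m n rule: linorder_cases) auto
  define S' where "S' = (\<Inter>n. U n)"
  define T' where "T' = (\<Inter>n. V n)"
  \<comment> \<open>The enumeration \<open>e\<close> may repeat elements, and must do so when the
    group is finite, so the pieces of all steps belonging to the same \<open>g\<close> are
    collected.\<close>
  define P where "P g = (\<Union>n\<in>{n. e n = g}. R n)" for g
  have S': "S - U n = (\<Union>m<n. R m)" for n
  proof (induction n)
    case (Suc n)
    have "U n \<subseteq> S" using dec(1) U_0 by (metis decseqD le0)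
    then show ?case using Suc R_sub(1)[of n] by (auto simp: U_Suc lessThan_Suc)
  qed (simp add: U_0)
  have T': "T - V n = (\<Union>m<n. \<phi> (e m) ` R m)" for n
  proof (induction n)
    case (Suc n)
    have "V n \<subseteq> T" using dec(2) V_0 by (metis decseqD le0)
    then show ?case using Suc R_sub(2)[of n] by (auto simp: V_Suc lessThan_Suc)
  qed (simp add: V_0)
  have image_P: "\<phi> g ` P g = (\<Union>n\<in>{n. e n = g}. \<phi> (e n) ` R n)" for g
    by (auto simp: P_def)
  have UN_less: "(\<Union>n. \<Union>m<n. X m) = (\<Union>n. X n)" for X :: "nat \<Rightarrow> 'a set"
    by (subst UN_UN_flatten[symmetric]) (simp add: UN_lessThan_UNIV)
  have "(\<Union>g\<in>carrier G. P g) = (\<Union>n. R n)"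
    using e(2) by (auto simp: P_def)
  also have "\<dots> = (\<Union>n. \<Union>m<n. R m)"
    by (rule UN_less[symmetric])
  also have "\<dots> = S - S'"
    unfolding S'[symmetric] S'_def by blast
  finally have UN_P: "(\<Union>g\<in>carrier G. P g) = S - S'" .
  have "(\<Union>g\<in>carrier G. \<phi> g ` P g) = (\<Union>n. \<phi> (e n) ` R n)"
    using e(2) by (auto simp: image_P)
  also have "\<dots> = (\<Union>n. \<Union>m<n. \<phi> (e m) ` R m)"
    by (rule UN_less[symmetric])
  also have "\<dots> = T - T'"
    unfolding T'[symmetric] T'_def by blast
  finally have UN_Q: "(\<Union>g\<in>carrier G. \<phi> g ` P g) = T - T'" .
  have sets: "S' \<in> sets M" "T' \<in> sets M"
    using UV by (auto simp: S'_def T'_def)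
  have disj: "P g \<inter> P h = {}" "\<phi> g ` P g \<inter> \<phi> h ` P h = {}" if "g \<noteq> h" for g h
  proof -
    have "R m \<inter> R n = {}" "\<phi> (e m) ` R m \<inter> \<phi> (e n) ` R n = {}" if "e m = g" "e n = h" for m n
      using R_disj[of m n] that \<open>g \<noteq> h\<close> by auto
    then show "P g \<inter> P h = {}" "\<phi> g ` P g \<inter> \<phi> h ` P h = {}"
      unfolding image_P unfolding P_def by fast+
  qed
  have "P g \<in> sets M" for g
    using RM by (auto simp: P_def)
  then have P: "decomposition (S - S') (T - T') P"
    using S T sets by (simp add: decomposition_def UN_P UN_Q malg_rel_def disj)
  have avoid: "\<forall>g\<in>carrier G. \<forall>x\<in>S'. \<phi> g x \<notin> T'"
  proof (intro ballI notI)
    fix g x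
    assume gx: "g \<in> carrier G" "x \<in> S'"
    assume *: "\<phi> g x \<in> T'"
    have "g \<in> range e"
      using e(1) gx(1) by simp
    then obtain n where n: "e n = g"
      by blast
    have x: "x \<in> space M" "x \<in> U n" "x \<notin> R n"
      using gx(2) sets.sets_into_space[OF sets(1)] U_Suc[of n] by (auto simp: S'_def)
    then show False
      using * n by (auto simp: R_def T'_def)
  qed
  have sub: "S' \<subseteq> S" "T' \<subseteq> T"
    using U_0 V_0 by (auto simp: S'_def T'_def)
  show ?thesis
    by (rule that[OF sets(1) sub(1) sets(2) sub(2) P avoid])
qed

section \<open>Saturations and the vanishing of the remainders\<close>

lemma saturation_invariant_iff:
  assumes "S \<subseteq> space M" "g \<in> carrier G" "x \<in> space M"
  shows "\<phi> g x \<in> (\<Union>h\<in>carrier G. \<phi> h ` S) \<longleftrightarrow> x \<in> (\<Union>h\<in>carrier G. \<phi> h ` S)"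
proof -
  \<comment> \<open>Each group element maps the saturation into itself. Applied to \<open>g\<close>
    and to \<open>inv g\<close>, this gives the two directions.\<close>
  have *: "\<phi> k y \<in> (\<Union>h\<in>carrier G. \<phi> h ` S)"
    if "k \<in> carrier G" and y: "y \<in> (\<Union>h\<in>carrier G. \<phi> h ` S)" for k y
  proof -
    obtain h s where hs: "h \<in> carrier G" "s \<in> S" "y = \<phi> h s"
      using y by blast
    then have "\<phi> k y = \<phi> (k \<otimes> h) s"
      using composition_rule[of s k h] that(1) assms(1) by auto
    then show ?thesis
      using hs that(1) by blast
  qed
  show ?thesis
    using *[OF assms(2), of x] *[of "inv g" "\<phi> g x"] act_inv_act[OF assms(2,3)] assms(2) by auto
qed

lemma null_sets_remainder:
  assumes "finite_measure M" and S: "S \<in> sets M" and S': "S' \<in> sets M" "S' \<subseteq> S"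
    and T: "T \<in> sets M" and T': "T' \<in> sets M" "T' \<subseteq> T"
    and P: "decomposition (S - S') (T - T') P"
    and eq: "\<forall>N. sets N = sets M \<and> invariant_measure G \<phi> N \<and> absolutely_continuous M N \<longrightarrow>
      emeasure N S = emeasure N T"
    and avoid: "\<forall>g\<in>carrier G. \<forall>x\<in>S'. \<phi> g x \<notin> T'"
  shows "S' \<in> null_sets M" and "T' \<in> null_sets M"
proof -
  interpret finite_measure M by fact
  have space: "S' \<subseteq> space M" "T' \<subseteq> space M"
    using S'(1) T'(1) by (simp_all add: sets.sets_into_space)
  \<comment> \<open>Proved for the saturation of an arbitrary measurable \<open>R\<close>, so that
    \<open>R = S'\<close> and \<open>R = T'\<close> can both be substituted below.\<close>
  have *: "emeasure M (C \<inter> S') = emeasure M (C \<inter> T')"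
    if C: "C = (\<Union>g\<in>carrier G. \<phi> g ` R)" and R: "R \<in> sets M" for C R
  proof -
    have sets: "C \<in> sets M"
      using C countable_carrier R image_act_sets by (auto intro!: sets.countable_UN')
    define N where "N = density M (indicator C)"
    have N: "sets N = sets M" "invariant_measure G \<phi> N" "absolutely_continuous M N"
      using sets saturation_invariant_iff[OF sets.sets_into_space[OF R]]
      unfolding N_def C[symmetric]
      by (simp_all add: absolutely_continuousI_density invariant_measure_density_indicator)
    have N_eq: "emeasure N X = emeasure M (C \<inter> X)" if "X \<in> sets M" for X
      unfolding N_def using sets that by (rule emeasure_restricted)
    have fin: "emeasure N X \<noteq> \<top>" if "X \<in> sets M" for X
      using N_eq[OF that] by simp
    have split: "emeasure N X = emeasure N (X - X') + emeasure N X'"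
      if "X \<in> sets M" "X' \<in> sets M" "X' \<subseteq> X" for X X'
      using that N(1) by (subst plus_emeasure) (auto intro!: arg_cong[of _ _ "emeasure N"])
    \<comment> \<open>The matched parts \<open>S - S'\<close> and \<open>T - T'\<close> have equal
      \<open>N\<close>-measure, so the same summand appears on both sides. It can be cancelled in
      \<open>ennreal\<close> because it is finite.\<close>
    have "emeasure N (T - T') + emeasure N S' = emeasure N (T - T') + emeasure N T'"
      using split[OF S S'] split[OF T T'] eq[rule_format, of N] N decomposition_emeasure_eq[OF P N] by metis
    moreover have "emeasure N (T - T') \<noteq> \<top>"
      using T T'(1) by (intro fin) auto
    ultimately have "emeasure N S' = emeasure N T'"
      by (simp add: ennreal_add_left_cancel)
    then show ?thesis
      using N_eq S' T' by simp
  qed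
  have self: "(\<Union>g\<in>carrier G. \<phi> g ` R) \<inter> R = R" if "R \<subseteq> space M" for R
  proof -
    have "x \<in> \<phi> \<one> ` R" if "x \<in> R" for x
    proof -
      have "\<phi> \<one> x = x"
        using that \<open>R \<subseteq> space M\<close> by (subst id_eq_one[symmetric]) auto
      then show ?thesis
        using that by force
    qed
    then show ?thesis
      using one_closed by blast
  qed
  have "(\<Union>g\<in>carrier G. \<phi> g ` S') \<inter> T' = {}"
    using avoid by blast
  then show "S' \<in> null_sets M"
    using *[OF refl S'(1)] self[OF space(1)] S'(1) by (simp add: null_sets_def)
  \<comment> \<open>Avoidance is symmetric: if \<open>g\<close> moved a point of \<open>T'\<close>
    into \<open>S'\<close>, then \<open>inv g\<close> would move it back into
    \<open>T'\<close>.\<close>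
  have "\<phi> g x \<notin> S'" if "g \<in> carrier G" "x \<in> T'" for g x
    using avoid[rule_format, of "inv g" "\<phi> g x"] act_inv_act[of g x] space that by auto
  then have "(\<Union>g\<in>carrier G. \<phi> g ` T') \<inter> S' = {}"
    by blast
  then show "T' \<in> null_sets M"
    using *[OF refl T'(1)] self[OF space(2)] T'(1) by (simp add: null_sets_def)
qed

text \<open>The theorem for representatives. Once the remainders are null, \<open>S - S'\<close> and
  \<open>S\<close> represent the same class, as do \<open>T - T'\<close> and \<open>T\<close>, so
  the partial decomposition is already one of \<open>S\<close> and \<open>T\<close>.\<close>

lemma exists_decomposition_iff:
  assumes "finite_measure M" and S: "S \<in> sets M" and T: "T \<in> sets M"
  shows "(\<exists>P. decomposition S T P) \<longleftrightarrow>
    (\<forall>N. sets N = sets M \<and> invariant_measure G \<phi> N \<and> absolutely_continuous M N \<longrightarrow>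
      emeasure N S = emeasure N T)"
proof
  assume "\<exists>P. decomposition S T P"
  then show "\<forall>N. sets N = sets M \<and> invariant_measure G \<phi> N \<and> absolutely_continuous M N \<longrightarrow>
      emeasure N S = emeasure N T"
    using decomposition_emeasure_eq by blast
next
  assume eq: "\<forall>N. sets N = sets M \<and> invariant_measure G \<phi> N \<and> absolutely_continuous M N \<longrightarrow>
      emeasure N S = emeasure N T"
  obtain S' T' P where *: "S' \<in> sets M" "S' \<subseteq> S" "T' \<in> sets M" "T' \<subseteq> T"
      "decomposition (S - S') (T - T') P"
      "\<forall>g\<in>carrier G. \<forall>x\<in>S'. \<phi> g x \<notin> T'"
    using maximal_partial_decomposition[OF S T] by blast
  have "S' \<in> null_sets M" "T' \<in> null_sets M"
    by (rule null_sets_remainder[OF assms(1) S *(1,2) T *(3,4,5) eq *(6)])+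
  moreover have "(S - S') - S \<union> (S - (S - S')) = S'" "(T - T') - T \<union> (T - (T - T')) = T'"
    using *(2,4) by blast+
  ultimately have rel: "(S - S', S) \<in> malg_rel M" "(T - T', T) \<in> malg_rel M"
    using S T *(1,3) by (simp_all only: malg_rel_def mem_Collect_eq case_prod_conv) auto
  have trans: "trans (malg_rel M)"
    using equiv_malg_rel by (rule equivE)
  have "decomposition S T P"
    using *(5) rel[THEN transD[OF trans, rotated]]
    by (simp add: decomposition_def)
  then show "\<exists>P. decomposition S T P"
    by blast
qed

end

theorem corollary1p4:
  fixes G :: "('g, 'm) monoid_scheme"
    and M :: "'a measure"
    and \<phi> :: "'g \<Rightarrow> 'a \<Rightarrow> 'a"
    and A B :: "'a set set"
  assumes "group G"
    and "countable (carrier G)"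
    and "standard_prob_space M"
    and "pmp_action G M \<phi>"
    and "A \<in> MALG M"
    and "B \<in> MALG M"
  shows "(\<forall>N :: 'a measure. sets N = sets M \<and> invariant_measure G \<phi> N \<and> absolutely_continuous M N
            \<longrightarrow> malg_emeasure N A = malg_emeasure N B)
         \<longleftrightarrow> equidecomposable G M \<phi> A B"
proof -
  interpret countable_pmp_action G M \<phi>
    using assms(2,4)
    by (simp add: countable_pmp_action_def countable_pmp_action_axioms_def pmp_action_def)
  have fin: "finite_measure M"
    using assms(3) by (simp add: standard_prob_space_def prob_space_def)
  obtain S T where S: "S \<in> sets M" "A = malg_class M S" and T: "T \<in> sets M" "B = malg_class M T"
    using assms(5,6) unfolding MALG_def by (auto elim!: quotientE)
  \<comment> \<open>Absolute continuity of \<open>N\<close> lets \<open>malg_emeasure\<close> be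
    evaluated on the representatives \<open>S\<close> and \<open>T\<close>, which reduces both sides
    to statements about sets.\<close>
  show ?thesis
    using exists_decomposition_iff[OF fin S(1) T(1)] equidecomposable_class_iff[OF S(1) T(1)]
      malg_emeasure_class[OF _ _ S(1)] malg_emeasure_class[OF _ _ T(1)]
    by (simp add: S(2) T(2) cong: conj_cong)
qed

end
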